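(* Let $k>0$ and let $C=\{\sigma\in\mathbb{M} : f_T(\sigma)\le k\}$ (Tresca yield domain), where $f_T(\sigma)=\frac12(\lambda_1(\sigma)-\lambda_3(\sigma))$. Let $\sigma\in\mathbb{M}$ satisfy $f_T(\sigma)=k$, and assume that $\lambda_2(\sigma)=\lambda_\ell(\sigma)$ for some $\ell\in\{1,3\}$ and $\lambda_2(\sigma)\ne\lambda_m(\sigma)$ with $m=4-\ell$. Then, for $\dot\varepsilon,\dot\varepsilon^{e},\dot\varepsilon^{p},\dot\sigma\in\mathbb{M}$, the rules $$\dot\varepsilon^{e}=\Pi_{T(C,\sigma)}\dot\varepsilon,\qquad \dot\varepsilon^{p}=\Pi_{N(C,\sigma)}\dot\varepsilon,\qquad \dot\sigma=\Pi_{T(C,\sigma)}\mathbb{H}(\dot\varepsilon)$$ can be rewritten as (i.e. are equivalent to) $$\dot\varepsilon^{p}=\rho_m(\sigma;\dot\varepsilon)\,\big[\mathbb{S}_m(\sigma;\dot\varepsilon)-\mathrm{tr}(\mathbb{S}_m(\sigma;\dot\varepsilon))\,v_m(\sigma)\otimes v_m(\sigma)\big],\qquad \dot\varepsilon^{e}=\dot\varepsilon-\dot\varepsilon^{p},$$ $$\dot\sigma=\lambda\,\mathrm{tr}(\dot\varepsilon)I+2\mu\Big(\dot\varepsilon-\rho_m(\sigma;\dot\varepsilon)\,\big[\mathbb{S}_m(\sigma;\dot\varepsilon)-\mathrm{tr}(\mathbb{S}_m(\sigma;\dot\varepsilon))\,v_m(\sigma)\otimes v_m(\sigma)\big]\B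ig).$$
   Context: $\mathbb{M}$ is the space of real symmetric $3\times3$ matrices with scalar product $\tau:\eta=\mathrm{tr}(\tau\eta)$ and associated (Frobenius) norm $\|\cdot\|$; $I$ is the identity matrix. For $\tau\in\mathbb{M}$, $\lambda_1(\tau)\ge\lambda_2(\tau)\ge\lambda_3(\tau)$ are its eigenvalues in decreasing order. For $x,y\in\mathbb{R}^3$, $x\otimes y=xy^t$. $\overline\tau=\tau-\frac{\mathrm{tr}(\tau)}{3}I$ is the deviator of $\tau\in\mathbb{M}$. The elasticity operator is $\mathbb{H}(\tau)=2\mu\tau+\lambda\,\mathrm{tr}(\tau)I$, with constants $\lambda>0$, $\mu>0$ (the constant $\lambda$ without subscript is unrelated to the eigenvalues). For a nonempty convex set $K\subset\mathbb{M}$ and $\sigma\in K$, the tangent cone is $T(K,\sigma)=\overline{\{\alpha(\eta-\sigma) : \eta\in K,\ \alpha>0\}}$ and the normal cone is $N(K,\sigma)=\{\eta\in\mathbb{M} : \tau:\eta\le 0\ \forall\tau\in T(K,\sigma)\}$. $\Pi_K$ denotes the orthogonal projection onto a nonempty closed convex set (in particular a subspace) $K$. For $\sigma,m$ as in the claim, $\{v_1(\sigma),v_2(\sigma),v_3(\sigma)\}$ is an orthonormal basis of eigenvectors of $\sigma$ with $\sigma v_k(\sigma)=\lambda_k(\sigma)v_k(\sigma)$. Define the subspace $G_m(\sigma)=\{\tau\in\mathbb{M} : \tau v_m(\sigma)=0\}$ and, for $\tau\in\mathbb{M}$, $$\mathbb{S}_m(\sigma;\tau)=\Pi_{G_m(\sigma)}\overline\tau-\lambda_m(\Pi_{G_m(\sigma)}\overline\tau)\,I,$$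 $$\rho_m(\sigma;\tau)=\max\left(\frac14+(-1)^{(3-m)/2}\,\frac34\,\frac{\sum_{j=1}^3\lambda_j(\Pi_{G_m(\sigma)}\overline\tau)}{\sum_{j=1}^3|\lambda_j(\Pi_{G_m(\sigma)}\overline\tau)|},\,0\right)\quad\text{if }\Pi_{G_m(\sigma)}\overline\tau\ne0,$$ and $\rho_m(\sigma;\tau)=0$ if $\Pi_{G_m(\sigma)}\overline\tau=0$. Here $\dot\varepsilon,\dot\varepsilon^e,\dot\varepsilon^p,\dot\sigma$ are the strain rate, elastic strain rate, plastic strain rate and stress rate; the statement concerns them simply as elements of $\mathbb{M}$. *)

theory Defs
  imports "HOL-Analysis.Analysis"
begin

text \<open>
  The space of real symmetric 3 by 3 matrices is a linear subspace of the library type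
  \<open>real^3^3\<close>. On it the scalar product \<open>tr (\<tau> \<eta>)\<close> is the library's inner product, so that
  \<^const>\<open>norm\<close> is the Frobenius norm (see \<open>frob_eq_inner\<close> and \<open>norm_eq_frob\<close> below) and
  \<^const>\<open>closest_point\<close> is the orthogonal projection onto a nonempty closed convex set.
\<close>

definition Msym :: "(real^3^3) set" where
  "Msym = {A. transpose A = A}"

definition frob :: "real^3^3 \<Rightarrow> real^3^3 \<Rightarrow> real" where
  "frob \<tau> \<eta> = trace (\<tau> ** \<eta>)"

lemma frob_eq_inner:
  assumes "\<tau> \<in> Msym"
  shows "frob \<tau> \<eta> = \<tau> \<bullet> \<eta>"
proof -
  have sym: "\<tau> $ i $ j = \<tau> $ j $ i" for i j
    using assms by (simp add: Msym_def transpose_def vec_eq_iff)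
  have "frob \<tau> \<eta> = (\<Sum>i\<in>UNIV. \<Sum>j\<in>UNIV. \<tau> $ i $ j * \<eta> $ j $ i)"
    by (simp add: frob_def trace_def matrix_matrix_mult_def)
  also have "\<dots> = (\<Sum>j\<in>UNIV. \<Sum>i\<in>UNIV. \<tau> $ j $ i * \<eta> $ j $ i)"
    using sym by (subst sum.swap) simp
  also have "\<dots> = \<tau> \<bullet> \<eta>"
    by (simp add: inner_vec_def)
  finally show ?thesis .
qed

lemma norm_eq_frob:
  assumes "\<tau> \<in> Msym"
  shows "norm \<tau> = sqrt (frob \<tau> \<tau>)"
  by (simp add: frob_eq_inner[OF assms] norm_eq_sqrt_inner)

text \<open>
  The eigenvalues, repeated according to multiplicity and in decreasing order: the decreasing
  list of the roots of the characteristic polynomial. It exists for every symmetric matrix, and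
  it is unique whenever it exists (\<open>eigvals_eqI\<close>).
\<close>

definition eigvals :: "real^3^3 \<Rightarrow> real list" where
  "eigvals A = (THE xs. length xs = 3 \<and> sorted_wrt (\<ge>) xs \<and>
     (\<forall>t. det (mat t - A) = (\<Prod>x\<leftarrow>xs. t - x)))"

definition eigval :: "nat \<Rightarrow> real^3^3 \<Rightarrow> real" where
  \<comment> \<open>used for \<open>k = 1, 2, 3\<close>\<close>
  "eigval k A = eigvals A ! (k - 1)"

lemma mset_eq_if_prod_list_eq:
  fixes xs ys :: "real list"
  assumes "\<And>t. (\<Prod>x\<leftarrow>xs. t - x) = (\<Prod>x\<leftarrow>ys. t - x)"
  shows "mset xs = mset ys"
proof -
  define p where "p zs = (\<Prod>x\<leftarrow>zs. [:- x, 1:])" for zs :: "real list"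
  have poly_p: "poly (p zs) t = (\<Prod>x\<leftarrow>zs. t - x)" for zs t
    by (induction zs) (simp_all add: p_def algebra_simps)
  have p_nz: "p zs \<noteq> 0" for zs
    by (auto simp: p_def prod_list_zero_iff)
  have proots_p: "proots (p zs) = mset zs" for zs
  proof (induction zs)
    case (Cons z zs)
    have "p (z # zs) = [:- z, 1:] * p zs"
      by (simp add: p_def)
    then show ?case
      using Cons p_nz[of zs] by (simp add: proots_mult del: mult_pCons_left)
  qed (simp add: p_def)
  have "p xs = p ys"
    using assms by (auto simp: poly_p simp flip: poly_eq_poly_eq_iff)
  then show ?thesis
    by (metis proots_p)
qed

lemma eigvals_eqI:
  assumes "length xs = 3" "sorted_wrt (\<ge>) xs"
    and "\<And>t. det (mat t - A) = (\<Prod>x\<leftarrow>xs. t - x)"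
  shows "eigvals A = xs"
  unfolding eigvals_def
proof (rule the_equality)
  fix ys :: "real list"
  assume ys: "length ys = 3 \<and> sorted_wrt (\<ge>) ys \<and> (\<forall>t. det (mat t - A) = (\<Prod>x\<leftarrow>ys. t - x))"
  have "mset ys = mset xs"
    using ys assms(3) by (intro mset_eq_if_prod_list_eq) metis
  moreover have "sorted (rev xs)" "sorted (rev ys)"
    using ys assms(2) by (simp_all add: sorted_wrt_rev)
  ultimately have "rev ys = rev xs"
    by (metis mset_rev properties_for_sort)
  then show "ys = xs"
    by simp
qed (use assms in auto)

definition deviator :: "real^3^3 \<Rightarrow> real^3^3" where
  "deviator \<tau> = \<tau> - (trace \<tau> / 3) *\<^sub>R mat 1"

definition tensor :: "real^3 \<Rightarrow> real^3 \<Rightarrow> real^3^3" (infixl "\<otimes>\<^sub>v" 70) where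
  "x \<otimes>\<^sub>v y = (columnvector x :: real^1^3) ** (rowvector y :: real^3^1)"

definition elasticity :: "real \<Rightarrow> real \<Rightarrow> real^3^3 \<Rightarrow> real^3^3" where
  "elasticity \<mu> lam \<tau> = (2 * \<mu>) *\<^sub>R \<tau> + (lam * trace \<tau>) *\<^sub>R mat 1"

definition tangent_cone :: "(real^3^3) set \<Rightarrow> real^3^3 \<Rightarrow> (real^3^3) set" where
  "tangent_cone K \<sigma> = closure {\<alpha> *\<^sub>R (\<eta> - \<sigma>) | \<alpha> \<eta>. \<eta> \<in> K \<and> \<alpha> > 0}"

definition normal_cone :: "(real^3^3) set \<Rightarrow> real^3^3 \<Rightarrow> (real^3^3) set" where
  "normal_cone K \<sigma> = {\<eta> \<in> Msym. \<forall>\<tau> \<in> tangent_cone K \<sigma>. frob \<tau> \<eta> \<le> 0}"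

definition f_tresca :: "real^3^3 \<Rightarrow> real" where
  "f_tresca \<sigma> = (eigval 1 \<sigma> - eigval 3 \<sigma>) / 2"

definition tresca_domain :: "real \<Rightarrow> (real^3^3) set" where
  "tresca_domain k = {\<sigma> \<in> Msym. f_tresca \<sigma> \<le> k}"

text \<open>
  The numbers \<open>\<lambda>\<^sub>k(\<sigma>)\<close> determine the basis of eigenvectors only up to a choice, so the objects
  below take as argument the family \<open>v\<close> itself; \<open>v 1\<close>, \<open>v 2\<close>, \<open>v 3\<close> are the relevant values.
\<close>

definition eigenbasis :: "real^3^3 \<Rightarrow> (nat \<Rightarrow> real^3) \<Rightarrow> bool" where
  "eigenbasis \<sigma> v \<longleftrightarrow>
     (\<forall>i\<in>{1..3}. \<forall>j\<in>{1..3}. v i \<bullet> v j = (if i = j then 1 else 0)) \<and>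
     (\<forall>k\<in>{1..3}. \<sigma> *v v k = eigval k \<sigma> *\<^sub>R v k)"

definition Gspace :: "nat \<Rightarrow> (nat \<Rightarrow> real^3) \<Rightarrow> (real^3^3) set" where
  "Gspace m v = {\<tau> \<in> Msym. \<tau> *v v m = 0}"

definition projG :: "nat \<Rightarrow> (nat \<Rightarrow> real^3) \<Rightarrow> real^3^3 \<Rightarrow> real^3^3" where
  "projG m v \<tau> = closest_point (Gspace m v) (deviator \<tau>)"

definition Smat :: "nat \<Rightarrow> (nat \<Rightarrow> real^3) \<Rightarrow> real^3^3 \<Rightarrow> real^3^3" where
  "Smat m v \<tau> = projG m v \<tau> - eigval m (projG m v \<tau>) *\<^sub>R mat 1"

definition rho :: "nat \<Rightarrow> (nat \<Rightarrow> real^3) \<Rightarrow> real^3^3 \<Rightarrow> real" where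
  \<comment> \<open>used for \<open>m = 1\<close> and \<open>m = 3\<close> only, so that the division in the exponent is exact\<close>
  "rho m v \<tau> =
     (if projG m v \<tau> = 0 then 0
      else max (1/4 + (-1) ^ ((3 - m) div 2) * (3/4) *
                 ((\<Sum>j=1..3. eigval j (projG m v \<tau>)) / (\<Sum>j=1..3. \<bar>eigval j (projG m v \<tau>)\<bar>))) 0)"

end

theory Submission
  imports Defs
begin

text \<open>
  Write \<open>w = v m\<close>, \<open>s = 1\<close> if \<open>m = 3\<close> and \<open>s = - 1\<close> if \<open>m = 1\<close>, so that
  \<open>\<sigma> = a I - 2 k s w \<otimes> w\<close>. The Tresca domain consists of the symmetric \<open>\<eta>\<close> with
  \<open>x \<bullet> \<eta> x - y \<bullet> \<eta> y \<le> 2 k\<close> for all unit vectors \<open>x\<close>, \<open>y\<close>. Testing with suitable elements of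
  the domain shows that its normal cone at \<open>\<sigma>\<close> is
  \<open>{s (A - tr A w \<otimes> w) | A symmetric, A w = 0, A \<ge> 0}\<close>. Projecting \<open>\<epsilon>\<close> onto this cone reduces,
  in an eigenbasis of \<open>s\<close> times the projection of the deviator of \<open>\<epsilon>\<close> onto \<open>{\<tau>. \<tau> w = 0}\<close>, to a
  problem about the two eigenvalues \<open>e \<ge> f\<close>, which \<open>rho\<close> solves explicitly. The projections onto the
  tangent cone follow from Moreau's decomposition, because the normal cone consists of
  trace-free matrices.
\<close>

section \<open>Symmetric matrices\<close>

lemma symmetric_dot_matrix_vector:
  fixes A :: "real^'n^'n"
  assumes "transpose A = A"
  shows "x \<bullet> (A *v y) = y \<bullet> (A *v x)"
  by (metis assms dot_lmul_matrix inner_commute vector_transpose_matrix)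

text \<open>A zero of a nonnegative form is a minimum, so the derivative of the form at
  \<open>w\<close> vanishes along directions of \<open>V\<close>. Along \<open>A *v w\<close>, which
  lies in \<open>V\<close> by assumption, this derivative is twice the squared norm of
  \<open>A *v w\<close>.\<close>

lemma semidefinite_null_vector:
  fixes A :: "real^'n^'n"
  assumes sym: "transpose A = A" and V: "subspace V"
    and psd: "\<And>x. x \<in> V \<Longrightarrow> 0 \<le> x \<bullet> (A *v x)"
    and w: "w \<in> V" "A *v w \<in> V" "w \<bullet> (A *v w) = 0"
  shows "A *v w = 0"
proof -
  define y where "y = A *v w"
  define q where "q = y \<bullet> (A *v y)"
  \<comment> \<open>The exact minimiser in \<open>t\<close> would have denominator \<open>q\<close>.
    The denominator \<open>1 + q\<close> also covers \<open>q = 0\<close> and still makes the form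
    negative unless \<open>y = 0\<close>.\<close>
  define t where "t = - (y \<bullet> y) / (1 + q)"
  have q: "0 \<le> q"
    using psd w(2) by (simp add: q_def y_def)
  have "w \<bullet> (A *v y) = y \<bullet> y"
    using symmetric_dot_matrix_vector[OF sym, of w y] by (simp add: y_def)
  then have "(w + t *\<^sub>R y) \<bullet> (A *v (w + t *\<^sub>R y)) = 2 * t * (y \<bullet> y) + t^2 * q"
    using w(3)
    by (simp add: matrix_vector_right_distrib matrix_vector_mult_scaleR inner_add_left
        inner_add_right q_def power2_eq_square algebra_simps flip: y_def)
  moreover have "w + t *\<^sub>R y \<in> V"
    using V w by (simp add: y_def subspace_add subspace_scale)
  ultimately have "0 \<le> 2 * t * (y \<bullet> y) + t^2 * q"
    using psd by metis
  then have "0 \<le> (2 * t * (y \<bullet> y) + t^2 * q) * (1 + q)^2"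
    by simp
  also have "\<dots> = 2 * (t * (1 + q)) * (y \<bullet> y) * (1 + q) + (t * (1 + q))^2 * q"
    by (simp add: power2_eq_square algebra_simps)
  also have "t * (1 + q) = - (y \<bullet> y)"
    using q by (simp add: t_def)
  finally have "(y \<bullet> y)^2 * (2 + q) \<le> 0"
    by (simp add: power2_eq_square algebra_simps)
  then have "(y \<bullet> y)^2 \<le> 0"
    using q by (simp add: mult_le_0_iff)
  then show ?thesis
    by (simp add: y_def)
qed

text \<open>The Rayleigh quotient attains its minimum \<open>c\<close> on the compact unit sphere of
  \<open>V\<close>. The form of \<open>A - mat c\<close> is nonnegative on \<open>V\<close> and
  vanishes at the minimiser, which is therefore an eigenvector. The bound by \<open>c\<close> later
  orders the eigenvalues.\<close>

lemma symmetric_least_eigenvector: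
  fixes A :: "real^'n^'n"
  assumes sym: "transpose A = A" and V: "subspace V"
    and inv: "\<And>x. x \<in> V \<Longrightarrow> A *v x \<in> V" and ne: "x0 \<in> V" "x0 \<noteq> 0"
  obtains w c where "w \<in> V" "norm w = 1" "A *v w = c *\<^sub>R w"
    "\<And>x. x \<in> V \<Longrightarrow> c * (x \<bullet> x) \<le> x \<bullet> (A *v x)"
proof -
  let ?S = "sphere 0 1 \<inter> V"
  have "compact ?S"
    using V by (simp add: closed_subspace compact_Int_closed)
  moreover have "x0 /\<^sub>R norm x0 \<in> ?S"
    using ne V by (simp add: subspace_scale)
  moreover have "continuous_on ?S (\<lambda>x. x \<bullet> (A *v x))"
    by (intro continuous_intros linear_continuous_on matrix_vector_mul_bounded_linear)
  ultimately obtain w where w: "w \<in> ?S" and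
    min: "\<And>x. x \<in> ?S \<Longrightarrow> w \<bullet> (A *v w) \<le> x \<bullet> (A *v x)"
    using continuous_attains_inf[of ?S] by blast
  define c where "c = w \<bullet> (A *v w)"
  have le: "c * (x \<bullet> x) \<le> x \<bullet> (A *v x)" if "x \<in> V" for x
  proof (cases "x = 0")
    case False
    then have "x /\<^sub>R norm x \<in> ?S"
      using that V by (simp add: subspace_scale)
    from min[OF this] have "c \<le> (x \<bullet> (A *v x)) / (norm x)^2"
      by (simp add: c_def matrix_vector_mult_scaleR power2_eq_square field_simps)
    then show ?thesis
      using False by (simp add: field_simps flip: power2_norm_eq_inner)
  qed simp
  have ww: "w \<bullet> w = 1"
    using w by (simp add: dot_square_norm)
  have M: "(A - mat c) *v x = A *v x - c *\<^sub>R x" for x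
  proof -
    have "mat c *v x = c *\<^sub>R x"
      by (simp add: vec_eq_iff matrix_vector_mult_def mat_def if_distrib[of "\<lambda>a. a * _"] cong: if_cong)
    then show ?thesis by (simp add: matrix_vector_mult_diff_rdistrib)
  qed
  have "(A - mat c) *v w = 0"
  proof (rule semidefinite_null_vector[OF _ V])
    show "transpose (A - mat c) = A - mat c"
      using sym by (simp add: transpose_def vec_eq_iff mat_def)
  qed (use w le inv V in \<open>auto simp: M inner_diff_right ww c_def[symmetric] subspace_diff subspace_scale\<close>)
  then show ?thesis
    using that[of w c] w le by (simp add: M)
qed

section \<open>Orthonormal triples and the spectral theorem in dimension three\<close>

definition orthonormal_triple :: "real^3 \<Rightarrow> real^3 \<Rightarrow> real^3 \<Rightarrow> bool" where
  "orthonormal_triple x y z \<longleftrightarrow>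
     x \<bullet> x = 1 \<and> y \<bullet> y = 1 \<and> z \<bullet> z = 1 \<and> x \<bullet> y = 0 \<and> x \<bullet> z = 0 \<and> y \<bullet> z = 0"

lemma orthonormal_tripleD:
  assumes "orthonormal_triple x y z"
  shows "x \<bullet> x = 1" "y \<bullet> y = 1" "z \<bullet> z = 1" "x \<bullet> y = 0" "x \<bullet> z = 0" "y \<bullet> z = 0"
    "y \<bullet> x = 0" "z \<bullet> x = 0" "z \<bullet> y = 0"
  using assms by (auto simp: orthonormal_triple_def inner_commute)

lemma tensor_nth: "(x \<otimes>\<^sub>v y) $ i $ j = x $ i * y $ j"
  by (simp add: tensor_def matrix_matrix_mult_def columnvector_def rowvector_def)

lemma tensor_mult_vector: "(x \<otimes>\<^sub>v y) *v z = (y \<bullet> z) *\<^sub>R x"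
  by (simp add: vec_eq_iff tensor_nth matrix_vector_mult_def sum_3 inner_vec_def algebra_simps)

lemma inner_tensor: "A \<bullet> (x \<otimes>\<^sub>v y) = x \<bullet> (A *v y)"
  by (simp add: tensor_nth matrix_vector_mult_def sum_3 inner_vec_def algebra_simps)

lemma trace_tensor: "trace (x \<otimes>\<^sub>v y) = x \<bullet> y"
  by (simp add: trace_def tensor_nth inner_vec_def)

lemma inner_mat_1: "A \<bullet> mat 1 = trace A"
  by (simp add: trace_def mat_def inner_vec_def if_distrib[of "\<lambda>a. _ * a"] cong: if_cong)

lemma tensor_in_Msym: "x \<otimes>\<^sub>v x \<in> Msym"
  by (simp add: Msym_def transpose_def vec_eq_iff tensor_nth mult.commute)

lemma mat_in_Msym: "mat c \<in> Msym"
  by (simp add: Msym_def)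

lemma subspace_Msym: "subspace Msym"
  by (auto simp: subspace_def Msym_def transpose_def vec_eq_iff)

lemmas Msym_intros =
  subspace_add[OF subspace_Msym] subspace_diff[OF subspace_Msym]
  subspace_scale[OF subspace_Msym] subspace_neg[OF subspace_Msym] tensor_in_Msym mat_in_Msym

text \<open>The matrix \<open>Q\<close> with rows \<open>x\<close>, \<open>y\<close>,
  \<open>z\<close> is a left inverse of its transpose, hence also a right inverse; the second
  identity, read entrywise, is the claim.\<close>

lemma orthonormal_triple_resolution:
  assumes "orthonormal_triple x y z"
  shows "mat 1 = x \<otimes>\<^sub>v x + y \<otimes>\<^sub>v y + z \<otimes>\<^sub>v z"
proof -
  let ?Q = "vector [x, y, z] :: real^3^3"
  have "?Q ** transpose ?Q = mat 1"
    using orthonormal_tripleD[OF assms]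
    by (simp add: vec_eq_iff forall_3 matrix_matrix_mult_def transpose_def mat_def inner_vec_def sum_3)
  then have "transpose ?Q ** ?Q = mat 1"
    by (simp add: matrix_left_right_inverse)
  then show ?thesis
    by (simp add: vec_eq_iff forall_3 matrix_matrix_mult_def transpose_def mat_def tensor_nth sum_3)
qed

lemma orthonormal_triple_spectral:
  assumes "orthonormal_triple x y z"
    and "A *v x = a *\<^sub>R x" "A *v y = b *\<^sub>R y" "A *v z = c *\<^sub>R z"
  shows "A = a *\<^sub>R (x \<otimes>\<^sub>v x) + b *\<^sub>R (y \<otimes>\<^sub>v y) + c *\<^sub>R (z \<otimes>\<^sub>v z)"
proof -
  have eq: "A ** (u \<otimes>\<^sub>v u) = (A *v u) \<otimes>\<^sub>v u" "(r *\<^sub>R u) \<otimes>\<^sub>v u = r *\<^sub>R (u \<otimes>\<^sub>v u)" for u r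
    by (simp_all add: vec_eq_iff tensor_nth matrix_matrix_mult_def matrix_vector_mult_def sum_3 algebra_simps)
  have "A = A ** (x \<otimes>\<^sub>v x + y \<otimes>\<^sub>v y + z \<otimes>\<^sub>v z)"
    by (simp flip: orthonormal_triple_resolution[OF assms(1)])
  then show ?thesis
    using assms(2-) by (simp add: matrix_add_ldistrib eq)
qed

text \<open>The spectral form factors \<open>mat t - A\<close> as
  \<open>transpose Q ** D ** Q\<close> with \<open>Q\<close> orthogonal and \<open>D\<close>
  diagonal, and the determinant of \<open>Q\<close> squares to 1.\<close>

lemma orthonormal_triple_charpoly:
  assumes "orthonormal_triple x y z"
    and "A *v x = a *\<^sub>R x" "A *v y = b *\<^sub>R y" "A *v z = c *\<^sub>R z"
  shows "det (mat t - A) = (t - a) * (t - b) * (t - c)"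
proof -
  let ?Q = "vector [x, y, z] :: real^3^3"
  let ?D = "(\<chi> i j. if i = j then vector [t - a, t - b, t - c] $ i else 0) :: real^3^3"
  have "?Q ** transpose ?Q = mat 1"
    using orthonormal_tripleD[OF assms(1)]
    by (simp add: vec_eq_iff forall_3 matrix_matrix_mult_def transpose_def mat_def inner_vec_def sum_3)
  then have Q: "det ?Q * det ?Q = 1"
    by (metis det_I det_mul det_transpose)
  have "mat t = t *\<^sub>R (mat 1 :: real^3^3)"
    by (simp add: vec_eq_iff mat_def)
  then have "mat t - A = (t - a) *\<^sub>R (x \<otimes>\<^sub>v x) + (t - b) *\<^sub>R (y \<otimes>\<^sub>v y) + (t - c) *\<^sub>R (z \<otimes>\<^sub>v z)"
    by (subst orthonormal_triple_spectral[OF assms])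
      (simp add: orthonormal_triple_resolution[OF assms(1)] algebra_simps)
  also have "\<dots> = transpose ?Q ** ?D ** ?Q"
    by (simp add: vec_eq_iff forall_3 matrix_matrix_mult_def transpose_def tensor_nth sum_3 algebra_simps)
  finally have "det (mat t - A) = det ?D * (det ?Q * det ?Q)"
    by (simp add: det_mul mult_ac)
  also have "\<dots> = (t - a) * (t - b) * (t - c)"
    unfolding Q by (simp add: det_3)
  finally show ?thesis .
qed

text \<open>Sorting covers eigenvalues whose order is not known in advance, such as
  \<open>s * e\<close>, \<open>s * f\<close>, \<open>0\<close> below, where it depends on the sign
  \<open>s\<close>.\<close>

lemma eigvals_orthonormal_triple:
  assumes "orthonormal_triple x y z"
    and "A *v x = a *\<^sub>R x" "A *v y = b *\<^sub>R y" "A *v z = c *\<^sub>R z"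
  shows "eigvals A = rev (sort [a, b, c])"
proof (rule eigvals_eqI)
  show "sorted_wrt (\<ge>) (rev (sort [a, b, c]))"
    using sorted_sort[of "[a, b, c]"] by (simp only: sorted_wrt_rev)
  show "det (mat t - A) = (\<Prod>u\<leftarrow>rev (sort [a, b, c]). t - u)" for t
    by (simp add: orthonormal_triple_charpoly[OF assms])
qed simp

text \<open>Deflation: \<open>y\<close> minimises the form on the complement of \<open>w\<close>,
  and \<open>x\<close> is an eigenvector in the complement of both, so \<open>b \<le> a\<close> by
  minimality of \<open>y\<close>. The prescribed \<open>w\<close> stays in the basis, which is
  needed later for \<open>w = v m\<close>.\<close>

lemma symmetric_eigenbasis_extend:
  assumes A: "A \<in> Msym" and w: "w \<bullet> w = 1" "A *v w = c *\<^sub>R w"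
  obtains x y a b where "orthonormal_triple x y w" "A *v x = a *\<^sub>R x" "A *v y = b *\<^sub>R y" "b \<le> a"
proof -
  have sym: "transpose A = A"
    using A by (simp add: Msym_def)
  define V where "V = {x. w \<bullet> x = 0}"
  have V: "subspace V"
    by (simp add: V_def subspace_hyperplane)
  have inv: "A *v x \<in> V" if "x \<in> V" for x
    using that symmetric_dot_matrix_vector[OF sym, of w x] w by (simp add: V_def inner_commute)
  obtain x0 :: "real^3" where "x0 \<noteq> 0" "orthogonal w x0"
    using orthogonal_to_vector_exists[of w] by auto
  then have "x0 \<in> V" "x0 \<noteq> 0"
    by (auto simp: V_def orthogonal_def)
  from symmetric_least_eigenvector[OF sym V inv this]
  obtain y b where y: "y \<in> V" "norm y = 1" "A *v y = b *\<^sub>R y"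
    and b: "\<And>x. x \<in> V \<Longrightarrow> b * (x \<bullet> x) \<le> x \<bullet> (A *v x)"
    by blast
  have yy: "y \<bullet> y = 1" "w \<bullet> y = 0"
    using y by (auto simp: dot_square_norm V_def)
  define W where "W = {x. w \<bullet> x = 0} \<inter> {x. y \<bullet> x = 0}"
  have W: "subspace W"
    unfolding W_def by (intro subspace_inter subspace_hyperplane)
  have invW: "A *v x \<in> W" if "x \<in> W" for x
    using that symmetric_dot_matrix_vector[OF sym, of w x] symmetric_dot_matrix_vector[OF sym, of y x]
      w y by (simp add: W_def inner_commute)
  \<comment> \<open>The cross product serves only to show that \<open>W\<close> contains a nonzero
    vector.\<close>
  have "cross3 w y \<in> W"
    by (simp add: W_def dot_cross_self)
  moreover have "cross3 w y \<noteq> 0"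
  proof
    assume "cross3 w y = 0"
    then have "norm (cross3 w y) = 0" by simp
    moreover have "(norm (cross3 w y))\<^sup>2 = 1"
      using norm_cross[of w y] w yy by (simp add: power2_norm_eq_inner)
    ultimately show False by simp
  qed
  ultimately obtain x a where x: "x \<in> W" "norm x = 1" "A *v x = a *\<^sub>R x"
    using symmetric_least_eigenvector[OF sym W invW] by metis
  have "x \<in> V" using x by (simp add: W_def V_def)
  from b[OF this] have "b \<le> a"
    using x by (simp add: dot_square_norm)
  moreover have "orthonormal_triple x y w"
    using x yy w by (simp add: orthonormal_triple_def W_def dot_square_norm inner_commute)
  ultimately show ?thesis
    using that x y by blast
qed

lemma symmetric_eigenbasis_exists:
  assumes A: "A \<in> Msym"
  obtains x y z where "orthonormal_triple x y z" "A *v x = eigval 1 A *\<^sub>R x"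
    "A *v y = eigval 2 A *\<^sub>R y" "A *v z = eigval 3 A *\<^sub>R z"
    "eigval 2 A \<le> eigval 1 A" "eigval 3 A \<le> eigval 2 A"
proof -
  have sym: "transpose A = A"
    using A by (simp add: Msym_def)
  obtain z c where z: "norm z = 1" "A *v z = c *\<^sub>R z"
    and min: "\<And>x. c * (x \<bullet> x) \<le> x \<bullet> (A *v x)"
    using symmetric_least_eigenvector[OF sym subspace_UNIV, of "axis 1 1"]
    by (auto simp: axis_eq_0_iff)
  from z have zz: "z \<bullet> z = 1" by (simp add: dot_square_norm)
  obtain x y a b where xy: "orthonormal_triple x y z" "A *v x = a *\<^sub>R x" "A *v y = b *\<^sub>R y" "b \<le> a"
    using symmetric_eigenbasis_extend[OF A zz z(2)] .
  have "c \<le> b"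
    using min[of y] xy by (simp add: orthonormal_triple_def)
  then have "eigvals A = [a, b, c]"
    using eigvals_orthonormal_triple[OF xy(1-3) z(2)] xy(4) by auto
  then show ?thesis
    using that[of x y z] xy z(2) \<open>c \<le> b\<close> by (simp add: eigval_def)
qed

text \<open>In an eigenbasis the form is a sum of the eigenvalues with nonnegative weights, the
  squared coordinates of \<open>x\<close>, whose total is \<open>x \<bullet> x\<close>.\<close>

lemma quadratic_form_bounds:
  assumes A: "A \<in> Msym"
  shows "x \<bullet> (A *v x) \<le> eigval 1 A * (x \<bullet> x)" "eigval 3 A * (x \<bullet> x) \<le> x \<bullet> (A *v x)"
proof -
  obtain u v w where u: "orthonormal_triple u v w" "A *v u = eigval 1 A *\<^sub>R u"
    "A *v v = eigval 2 A *\<^sub>R v" "A *v w = eigval 3 A *\<^sub>R w"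
    and le: "eigval 2 A \<le> eigval 1 A" "eigval 3 A \<le> eigval 2 A"
    using symmetric_eigenbasis_exists[OF A] .
  have sq: "x \<bullet> ((z \<otimes>\<^sub>v z) *v x) = (z \<bullet> x)^2" for z
    by (simp add: tensor_mult_vector power2_eq_square inner_commute)
  have "x \<bullet> (mat 1 *v x) = (u \<bullet> x)^2 + (v \<bullet> x)^2 + (w \<bullet> x)^2"
    unfolding orthonormal_triple_resolution[OF u(1)]
    by (simp add: matrix_vector_mult_add_rdistrib inner_add_right sq)
  then have n: "x \<bullet> x = (u \<bullet> x)^2 + (v \<bullet> x)^2 + (w \<bullet> x)^2"
    by simp
  have "x \<bullet> (A *v x) = eigval 1 A * (u \<bullet> x)^2 + eigval 2 A * (v \<bullet> x)^2 + eigval 3 A * (w \<bullet> x)^2"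
    by (subst orthonormal_triple_spectral[OF u])
      (simp add: matrix_vector_mult_add_rdistrib inner_add_right sq flip: scaleR_matrix_vector_assoc)
  then show "x \<bullet> (A *v x) \<le> eigval 1 A * (x \<bullet> x)" "eigval 3 A * (x \<bullet> x) \<le> x \<bullet> (A *v x)"
    using le unfolding n
    by (simp_all add: distrib_left add_mono mult_right_mono)
qed

section \<open>Tangent and normal cones\<close>

text \<open>Expanding the square, the obtuse angle at \<open>p\<close> makes the squared distance
  from \<open>z\<close> to \<open>y\<close> exceed that to \<open>p\<close> by at least the squared
  distance from \<open>y\<close> to \<open>p\<close>.\<close>

lemma closest_point_eqI:
  fixes p :: "'a::euclidean_space"
  assumes "p \<in> K" and "\<And>y. y \<in> K \<Longrightarrow> (z - p) \<bullet> (y - p) \<le> 0"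
  shows "closest_point K z = p"
proof -
  have key: "(dist z p)^2 + (dist y p)^2 \<le> (dist z y)^2" if "y \<in> K" for y
  proof -
    have "(dist z y)^2 = (dist z p)^2 + (dist y p)^2 - 2 * ((z - p) \<bullet> (y - p))"
      by (simp add: dist_norm power2_norm_eq_inner inner_diff_left inner_diff_right inner_commute)
    then show ?thesis
      using assms(2)[OF that] by simp
  qed
  have "dist z p \<le> dist z y" if "y \<in> K" for y
  proof (rule power2_le_imp_le)
    show "(dist z p)^2 \<le> (dist z y)^2"
      using key[OF that] zero_le_power2[of "dist y p"] by linarith
  qed simp
  \<comment> \<open>\<open>closest_point\<close> is a choice among the minimisers, so uniqueness has
    to be shown as well.\<close>
  moreover have "y = p" if "y \<in> K" "dist z y \<le> dist z p" for y
  proof -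
    have "(dist z y)^2 \<le> (dist z p)^2"
      using that(2) by (simp add: power_mono)
    then have "(dist y p)^2 \<le> 0"
      using key[OF that(1)] by linarith
    then show ?thesis
      by simp
  qed
  ultimately show ?thesis
    unfolding closest_point_def using assms(1) by (intro some_equality) blast+
qed

lemma tangent_cone_subset_Msym:
  assumes "K \<subseteq> Msym" "\<sigma> \<in> K"
  shows "tangent_cone K \<sigma> \<subseteq> Msym"
  unfolding tangent_cone_def
  by (rule closure_minimal) (use assms in \<open>auto intro!: Msym_intros simp: closed_subspace subspace_Msym\<close>)

text \<open>Two generators with factors \<open>a\<close> and \<open>b\<close> add up to one with
  factor \<open>a + b\<close>, taken at the convex combination of their base points with weights
  proportional to \<open>a\<close> and \<open>b\<close>. Closure preserves convexity and
  conicity.\<close>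

lemma tangent_cone_convex_cone:
  assumes K: "convex K" "\<sigma> \<in> K"
  shows "convex (tangent_cone K \<sigma>) \<and> cone (tangent_cone K \<sigma>)"
proof -
  let ?S = "{\<alpha> *\<^sub>R (\<eta> - \<sigma>) | \<alpha> \<eta>. \<eta> \<in> K \<and> \<alpha> > 0}"
  have "x + y \<in> ?S" if xy: "x \<in> ?S" "y \<in> ?S" for x y
  proof -
    obtain a \<eta> b \<theta> where ab: "x = a *\<^sub>R (\<eta> - \<sigma>)" "y = b *\<^sub>R (\<theta> - \<sigma>)"
      "\<eta> \<in> K" "\<theta> \<in> K" "0 < a" "0 < b"
      using xy by blast
    let ?\<zeta> = "(a / (a + b)) *\<^sub>R \<eta> + (b / (a + b)) *\<^sub>R \<theta>"
    have "?\<zeta> \<in> K"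
      using ab by (intro convexD[OF K(1)]) (simp_all flip: add_divide_distrib)
    moreover have "x + y = (a + b) *\<^sub>R (?\<zeta> - \<sigma>)"
    proof -
      have "(a + b) *\<^sub>R ?\<zeta> = a *\<^sub>R \<eta> + b *\<^sub>R \<theta>"
        using ab by (simp add: scaleR_add_right)
      then show ?thesis
        using ab by (simp add: scaleR_diff_right scaleR_add_left)
    qed
    moreover have "0 < a + b"
      using ab by simp
    ultimately show ?thesis
      by blast
  qed
  moreover have "c *\<^sub>R x \<in> ?S" if x: "x \<in> ?S" "0 \<le> c" for x c
  proof (cases "c = 0")
    case True
    \<comment> \<open>The factors in the generating set are positive, so zero is represented through
      \<open>\<eta> = \<sigma>\<close>.\<close>
    then show ?thesis
      using K(2) by (intro CollectI exI[of _ 1] exI[of _ \<sigma>]) simp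
  next
    case False
    obtain a \<eta> where "x = a *\<^sub>R (\<eta> - \<sigma>)" "\<eta> \<in> K" "0 < a"
      using x by blast
    then show ?thesis
      using False x(2) by (intro CollectI exI[of _ "c * a"] exI[of _ \<eta>]) simp
  qed
  ultimately have "convex ?S \<and> cone ?S"
    unfolding convex_cone by blast
  then show ?thesis
    by (simp add: tangent_cone_def cone_closure)
qed

text \<open>The inequality is positively homogeneous and closed in the tangent direction, so it
  passes from the differences \<open>\<eta> - \<sigma>\<close> to their multiples and to
  limits.\<close>

lemma normal_cone_iff:
  assumes K: "K \<subseteq> Msym" "\<sigma> \<in> K"
  shows "n \<in> normal_cone K \<sigma> \<longleftrightarrow> n \<in> Msym \<and> (\<forall>\<eta>\<in>K. n \<bullet> (\<eta> - \<sigma>) \<le> 0)"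
proof -
  have frob: "frob \<tau> n = n \<bullet> \<tau>" if "\<tau> \<in> tangent_cone K \<sigma>" for \<tau>
    using that tangent_cone_subset_Msym[OF K] by (subst frob_eq_inner) (auto simp: inner_commute)
  let ?S = "{\<alpha> *\<^sub>R (\<eta> - \<sigma>) | \<alpha> \<eta>. \<eta> \<in> K \<and> \<alpha> > 0}"
  have "n \<bullet> (\<eta> - \<sigma>) \<le> 0" if "\<And>\<tau>. \<tau> \<in> tangent_cone K \<sigma> \<Longrightarrow> n \<bullet> \<tau> \<le> 0" "\<eta> \<in> K" for \<eta>
  proof (rule that(1))
    have "\<eta> - \<sigma> \<in> ?S"
      using that(2) by (intro CollectI exI[of _ 1] exI[of _ \<eta>]) simp
    then show "\<eta> - \<sigma> \<in> tangent_cone K \<sigma>"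
      unfolding tangent_cone_def by (rule subsetD[OF closure_subset])
  qed
  moreover have "n \<bullet> \<tau> \<le> 0" if "\<And>\<eta>. \<eta> \<in> K \<Longrightarrow> n \<bullet> (\<eta> - \<sigma>) \<le> 0" "\<tau> \<in> tangent_cone K \<sigma>" for \<tau>
  proof -
    have "?S \<subseteq> {\<tau>. n \<bullet> \<tau> \<le> 0}"
      using that(1) by (auto simp: mult_nonneg_nonpos)
    then have "tangent_cone K \<sigma> \<subseteq> {\<tau>. n \<bullet> \<tau> \<le> 0}"
      unfolding tangent_cone_def by (rule closure_minimal) (rule closed_halfspace_le)
    then show ?thesis
      using that(2) by blast
  qed
  ultimately have "(\<forall>\<tau>\<in>tangent_cone K \<sigma>. n \<bullet> \<tau> \<le> 0) \<longleftrightarrow> (\<forall>\<eta>\<in>K. n \<bullet> (\<eta> - \<sigma>) \<le> 0)"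
    by metis
  then show ?thesis
    by (simp add: normal_cone_def frob cong: ball_cong)
qed

lemma normal_coneD:
  assumes "K \<subseteq> Msym" "\<sigma> \<in> K" "n \<in> normal_cone K \<sigma>" "\<tau> \<in> tangent_cone K \<sigma>"
  shows "n \<bullet> \<tau> \<le> 0"
proof -
  have "\<tau> \<in> Msym"
    using tangent_cone_subset_Msym[OF assms(1,2)] assms(4) by blast
  then show ?thesis
    using assms(3,4) by (auto simp: normal_cone_def frob_eq_inner inner_commute)
qed

text \<open>Bipolar theorem: with \<open>q\<close> the projection of \<open>z\<close> onto the
  tangent cone, \<open>z - q\<close> is a normal. Hence its product with \<open>z\<close> is at most
  0, while its product with \<open>q\<close> is at least 0, and so \<open>z = q\<close>.\<close>

lemma tangent_cone_bipolar:
  assumes K: "K \<subseteq> Msym" "convex K" "\<sigma> \<in> K"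
    and z: "z \<in> Msym" "\<And>n. n \<in> normal_cone K \<sigma> \<Longrightarrow> n \<bullet> z \<le> 0"
  shows "z \<in> tangent_cone K \<sigma>"
proof -
  let ?T = "tangent_cone K \<sigma>"
  have T: "convex ?T" "cone ?T" "closed ?T"
    using tangent_cone_convex_cone[OF K(2,3)] by (auto simp: tangent_cone_def)
  have sub: "?T \<subseteq> Msym"
    by (rule tangent_cone_subset_Msym[OF K(1,3)])
  have "1 *\<^sub>R (\<sigma> - \<sigma>) \<in> {\<alpha> *\<^sub>R (\<eta> - \<sigma>) | \<alpha> \<eta>. \<eta> \<in> K \<and> \<alpha> > 0}"
    using K(3) zero_less_one by blast
  from subsetD[OF closure_subset this] have 0: "0 \<in> ?T"
    by (simp add: tangent_cone_def)
  define q where "q = closest_point ?T z"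
  have q: "q \<in> ?T"
    unfolding q_def using T(3) 0 by (intro closest_point_in_set) auto
  have obtuse: "(z - q) \<bullet> (\<tau> - q) \<le> 0" if "\<tau> \<in> ?T" for \<tau>
    unfolding q_def using T that by (intro closest_point_dot)
  \<comment> \<open>Shifting test directions by \<open>q\<close> stays in the convex cone and turns
    the obtuse-angle inequality into polarity.\<close>
  have add: "\<tau> + q \<in> ?T" if "\<tau> \<in> ?T" for \<tau>
    using T(1,2) that q convex_cone[of ?T] by blast
  have polar: "(z - q) \<bullet> \<tau> \<le> 0" if "\<tau> \<in> ?T" for \<tau>
    using obtuse[OF add[OF that]] by simp
  have "z - q \<in> normal_cone K \<sigma>"
    unfolding normal_cone_def
  proof (intro CollectI conjI ballI)
    show "z - q \<in> Msym"
      using z(1) subsetD[OF sub q] by (intro Msym_intros)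
    show "frob \<tau> (z - q) \<le> 0" if "\<tau> \<in> ?T" for \<tau>
      using polar[OF that] that sub by (subst frob_eq_inner) (auto simp: inner_commute)
  qed
  from z(2)[OF this] have "(z - q) \<bullet> z \<le> 0" .
  moreover have "0 \<le> (z - q) \<bullet> q"
    using obtuse[OF 0] by simp
  ultimately have "(z - q) \<bullet> (z - q) \<le> 0"
    by (simp add: inner_diff_right)
  then have "z - q = 0"
    using inner_ge_zero[of "z - q"] by (metis inner_eq_zero_iff order_antisym)
  then show ?thesis
    using q by simp
qed

text \<open>The remainder \<open>z - p\<close> is polar to the normal cone, hence tangent by the
  bipolar theorem. Orthogonality of the two parts then gives the variational inequality for both
  projections.\<close>

lemma moreau_decomposition:
  assumes K: "K \<subseteq> Msym" "convex K" "\<sigma> \<in> K"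
    and z: "z \<in> Msym" and p: "p \<in> normal_cone K \<sigma>" "p \<bullet> (z - p) = 0"
    and le: "\<And>n. n \<in> normal_cone K \<sigma> \<Longrightarrow> n \<bullet> (z - p) \<le> 0"
  shows "closest_point (normal_cone K \<sigma>) z = p" "closest_point (tangent_cone K \<sigma>) z = z - p"
proof -
  show "closest_point (normal_cone K \<sigma>) z = p"
  proof (rule closest_point_eqI[OF p(1)])
    show "(z - p) \<bullet> (n - p) \<le> 0" if "n \<in> normal_cone K \<sigma>" for n
      using le[OF that] p(2) by (subst inner_commute, subst inner_diff_left) linarith
  qed
  have "z - p \<in> tangent_cone K \<sigma>"
    using z p(1) le by (intro tangent_cone_bipolar[OF K] Msym_intros) (auto simp: normal_cone_def)
  then show "closest_point (tangent_cone K \<sigma>) z = z - p"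
  proof (rule closest_point_eqI)
    show "(z - (z - p)) \<bullet> (\<tau> - (z - p)) \<le> 0" if "\<tau> \<in> tangent_cone K \<sigma>" for \<tau>
      using normal_coneD[OF K(1,3) p(1) that] p(2) by (simp add: inner_diff_right[of p \<tau>])
  qed
qed

section \<open>The Tresca domain\<close>

text \<open>The extreme eigenvalues are the maximum and minimum of the form on unit vectors. The
  domain thus becomes an intersection of half-spaces, linear in \<open>\<eta>\<close>.\<close>

lemma tresca_domain_iff:
  "\<eta> \<in> tresca_domain k \<longleftrightarrow> \<eta> \<in> Msym \<and>
     (\<forall>x y. x \<bullet> x = 1 \<longrightarrow> y \<bullet> y = 1 \<longrightarrow> x \<bullet> (\<eta> *v x) - y \<bullet> (\<eta> *v y) \<le> 2 * k)"
proof (cases "\<eta> \<in> Msym")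
  case True
  obtain x y z where xyz: "orthonormal_triple x y z" "\<eta> *v x = eigval 1 \<eta> *\<^sub>R x"
    "\<eta> *v y = eigval 2 \<eta> *\<^sub>R y" "\<eta> *v z = eigval 3 \<eta> *\<^sub>R z"
    using symmetric_eigenbasis_exists[OF True] by metis
  note on = orthonormal_tripleD[OF xyz(1)]
  have att: "x \<bullet> (\<eta> *v x) - z \<bullet> (\<eta> *v z) = eigval 1 \<eta> - eigval 3 \<eta>"
    unfolding xyz(2,4) using on by simp
  have bound: "u \<bullet> (\<eta> *v u) - t \<bullet> (\<eta> *v t) \<le> eigval 1 \<eta> - eigval 3 \<eta>"
    if "u \<bullet> u = 1" "t \<bullet> t = 1" for u t
    using quadratic_form_bounds(1)[OF True, of u] quadratic_form_bounds(2)[OF True, of t] that by simp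
  have "(\<forall>x y. x \<bullet> x = 1 \<longrightarrow> y \<bullet> y = 1 \<longrightarrow> x \<bullet> (\<eta> *v x) - y \<bullet> (\<eta> *v y) \<le> 2 * k)
      \<longleftrightarrow> eigval 1 \<eta> - eigval 3 \<eta> \<le> 2 * k"
  proof
    assume *: "\<forall>x y. x \<bullet> x = 1 \<longrightarrow> y \<bullet> y = 1 \<longrightarrow> x \<bullet> (\<eta> *v x) - y \<bullet> (\<eta> *v y) \<le> 2 * k"
    show "eigval 1 \<eta> - eigval 3 \<eta> \<le> 2 * k"
      using *[rule_format, OF on(1) on(3)] att by linarith
  next
    assume *: "eigval 1 \<eta> - eigval 3 \<eta> \<le> 2 * k"
    show "\<forall>x y. x \<bullet> x = 1 \<longrightarrow> y \<bullet> y = 1 \<longrightarrow> x \<bullet> (\<eta> *v x) - y \<bullet> (\<eta> *v y) \<le> 2 * k"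
      by (intro allI impI order_trans[OF bound *])
  qed
  moreover have "\<eta> \<in> tresca_domain k \<longleftrightarrow> eigval 1 \<eta> - eigval 3 \<eta> \<le> 2 * k"
    using True by (simp add: tresca_domain_def f_tresca_def field_simps)
  ultimately show ?thesis
    using True by simp
qed (simp add: tresca_domain_def)

lemma convex_tresca_domain: "convex (tresca_domain k)"
proof (rule convexI)
  fix \<eta> \<theta> and u v :: real
  assume 1: "\<eta> \<in> tresca_domain k" "\<theta> \<in> tresca_domain k" and uv: "0 \<le> u" "0 \<le> v" "u + v = 1"
  show "u *\<^sub>R \<eta> + v *\<^sub>R \<theta> \<in> tresca_domain k"
    unfolding tresca_domain_iff
  proof (intro conjI allI impI)
    show "u *\<^sub>R \<eta> + v *\<^sub>R \<theta> \<in> Msym"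
      using 1 by (intro Msym_intros) (auto simp: tresca_domain_def)
    fix x y :: "real^3" assume xy: "x \<bullet> x = 1" "y \<bullet> y = 1"
    have "u * (x \<bullet> (\<eta> *v x) - y \<bullet> (\<eta> *v y)) + v * (x \<bullet> (\<theta> *v x) - y \<bullet> (\<theta> *v y)) \<le> 2 * k"
      using 1 uv xy by (intro convex_bound_le) (auto simp: tresca_domain_iff)
    then show "x \<bullet> ((u *\<^sub>R \<eta> + v *\<^sub>R \<theta>) *v x) - y \<bullet> ((u *\<^sub>R \<eta> + v *\<^sub>R \<theta>) *v y) \<le> 2 * k"
      by (simp add: matrix_vector_mult_add_rdistrib inner_add_right algebra_simps
          flip: scaleR_matrix_vector_assoc)
  qed
qed

text \<open>Supplies the test elements for the normal cone: the form of \<open>P\<close> takes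
  values in \<open>[0, 1]\<close> on unit vectors, so that of the matrix varies by at most
  \<open>2 * k\<close>. Taking \<open>P = w \<otimes>\<^sub>v w\<close> gives
  \<open>\<sigma>\<close> itself.\<close>

lemma tresca_domain_memI:
  assumes s: "s = 1 \<or> s = (-1::real)" and k: "0 < k" and P: "P \<in> Msym"
    and b: "\<And>y. y \<bullet> y = 1 \<Longrightarrow> 0 \<le> y \<bullet> (P *v y) \<and> y \<bullet> (P *v y) \<le> 1"
  shows "a *\<^sub>R mat 1 - (2 * k * s) *\<^sub>R P \<in> tresca_domain k"
  unfolding tresca_domain_iff
proof (intro conjI allI impI)
  show "a *\<^sub>R mat 1 - (2 * k * s) *\<^sub>R P \<in> Msym"
    using P by (intro Msym_intros)
  fix x y :: "real^3" assume xy: "x \<bullet> x = 1" "y \<bullet> y = 1"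
  have "s * (y \<bullet> (P *v y) - x \<bullet> (P *v x)) \<le> 1"
    using s b[OF xy(1)] b[OF xy(2)] by auto
  then have "2 * k * (s * (y \<bullet> (P *v y) - x \<bullet> (P *v x))) \<le> 2 * k * 1"
    using k by (intro mult_left_mono) auto
  then show "x \<bullet> ((a *\<^sub>R mat 1 - (2 * k * s) *\<^sub>R P) *v x)
      - y \<bullet> ((a *\<^sub>R mat 1 - (2 * k * s) *\<^sub>R P) *v y) \<le> 2 * k"
    using xy by (simp add: matrix_vector_mult_diff_rdistrib inner_diff_right algebra_simps
        flip: scaleR_matrix_vector_assoc)
qed

section \<open>Normal cone at an edge of the Tresca domain\<close>

lemma tensor_unit_bounds:
  assumes "u \<bullet> u = 1" "y \<bullet> y = 1"
  shows "0 \<le> y \<bullet> ((u \<otimes>\<^sub>v u) *v y) \<and> y \<bullet> ((u \<otimes>\<^sub>v u) *v y) \<le> 1"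
proof -
  have "(u \<bullet> y)^2 \<le> 1"
    using Cauchy_Schwarz_ineq[of u y] assms by simp
  then show ?thesis
    by (simp add: tensor_mult_vector inner_commute power2_eq_square)
qed

text \<open>Diagonalising \<open>A\<close> gives a nonnegative combination of the matrices
  \<open>s *\<^sub>R (u \<otimes>\<^sub>v u - w \<otimes>\<^sub>v w)\<close> with unit
  \<open>u\<close> orthogonal to \<open>w\<close>. Each is an outer normal, since its product with
  an element of the domain is at most \<open>2 * k\<close>, with equality at
  \<open>\<sigma>\<close>.\<close>

lemma tresca_normal_coneI:
  assumes s: "s = 1 \<or> s = (-1::real)" and k: "0 < k" and w: "w \<bullet> w = 1"
    and \<sigma>: "\<sigma> = a *\<^sub>R mat 1 - (2 * k * s) *\<^sub>R (w \<otimes>\<^sub>v w)"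
    and A: "A \<in> Msym" "A *v w = 0" "\<And>x. 0 \<le> x \<bullet> (A *v x)"
  shows "s *\<^sub>R (A - trace A *\<^sub>R (w \<otimes>\<^sub>v w)) \<in> normal_cone (tresca_domain k) \<sigma>"
proof -
  have \<sigma>C: "\<sigma> \<in> tresca_domain k"
    unfolding \<sigma> using tensor_unit_bounds[OF w] by (intro tresca_domain_memI s k tensor_in_Msym)
  have Aw: "A *v w = 0 *\<^sub>R w"
    using A(2) by simp
  obtain x y b c where xy: "orthonormal_triple x y w" "A *v x = b *\<^sub>R x" "A *v y = c *\<^sub>R y"
    using symmetric_eigenbasis_extend[OF A(1) w Aw] .
  note on = orthonormal_tripleD[OF xy(1)]
  have bc: "0 \<le> b" "0 \<le> c"
    using A(3)[of x] A(3)[of y] xy on by auto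
  have A_eq: "A = b *\<^sub>R (x \<otimes>\<^sub>v x) + c *\<^sub>R (y \<otimes>\<^sub>v y)"
    using orthonormal_triple_spectral[OF xy Aw] by simp
  have tr: "trace A = b + c"
    unfolding A_eq by (simp add: inner_add_left inner_mat_1[symmetric])
      (simp add: inner_mat_1 trace_tensor on)
  have sub: "tresca_domain k \<subseteq> Msym"
    by (auto simp: tresca_domain_def)
  show ?thesis
    unfolding normal_cone_iff[OF sub \<sigma>C]
  proof (intro conjI ballI)
    show "s *\<^sub>R (A - trace A *\<^sub>R (w \<otimes>\<^sub>v w)) \<in> Msym"
      using A by (intro Msym_intros)
    fix \<eta> assume \<eta>: "\<eta> \<in> tresca_domain k"
    \<comment> \<open>For \<open>s = -1\<close> the unit vectors \<open>u\<close> and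
      \<open>w\<close> exchange roles in the half-space condition.\<close>
    have gap: "s * (u \<bullet> (\<eta> *v u) - w \<bullet> (\<eta> *v w)) - 2 * k \<le> 0" if "u \<bullet> u = 1" for u
      using \<eta> s w that by (auto simp: tresca_domain_iff)
    have T: "(u \<otimes>\<^sub>v u) \<bullet> (\<eta> - \<sigma>) = u \<bullet> (\<eta> *v u) - a * (u \<bullet> u) + 2 * k * s * (w \<bullet> u)^2" for u
      by (subst inner_commute) (simp add: inner_tensor \<sigma> matrix_vector_mult_diff_rdistrib tensor_mult_vector
        inner_diff_right power2_eq_square inner_commute flip: scaleR_matrix_vector_assoc)
    have ss: "s * s = 1" using s by auto
    have "(s *\<^sub>R (A - trace A *\<^sub>R (w \<otimes>\<^sub>v w))) \<bullet> (\<eta> - \<sigma>) =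
        b * (s * (x \<bullet> (\<eta> *v x) - w \<bullet> (\<eta> *v w)) - 2 * k * (s * s)) +
        c * (s * (y \<bullet> (\<eta> *v y) - w \<bullet> (\<eta> *v w)) - 2 * k * (s * s))"
      unfolding tr by (subst A_eq) (simp only: inner_diff_left inner_add_left inner_scaleR_left T on, simp add: algebra_simps)
    also have "\<dots> \<le> 0"
      unfolding ss using gap[of x] gap[of y] on bc by (intro add_nonpos_nonpos mult_nonneg_nonpos) auto
    finally show "(s *\<^sub>R (A - trace A *\<^sub>R (w \<otimes>\<^sub>v w))) \<bullet> (\<eta> - \<sigma>) \<le> 0" .
  qed
qed

text \<open>Three families of test elements determine \<open>n\<close>: shifts by the identity give
  trace zero, replacing \<open>w\<close> by another unit vector makes \<open>w\<close> a least
  eigenvector of \<open>s *\<^sub>R n\<close>, and adding an orthogonal tensor makes this matrix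
  nonnegative on the complement of \<open>w\<close>.\<close>

lemma tresca_normal_coneE:
  assumes s: "s = 1 \<or> s = (-1::real)" and k: "0 < k" and w: "w \<bullet> w = 1"
    and \<sigma>: "\<sigma> = a *\<^sub>R mat 1 - (2 * k * s) *\<^sub>R (w \<otimes>\<^sub>v w)"
    and n: "n \<in> normal_cone (tresca_domain k) \<sigma>"
  obtains A where "A \<in> Msym" "A *v w = 0" "\<And>x. 0 \<le> x \<bullet> (A *v x)"
    "n = s *\<^sub>R (A - trace A *\<^sub>R (w \<otimes>\<^sub>v w))"
proof -
  have ss: "s * s = 1" using s by auto
  have mem: "b *\<^sub>R mat 1 - (2 * k * s) *\<^sub>R (u \<otimes>\<^sub>v u) \<in> tresca_domain k" if "u \<bullet> u = 1" for b u
    using tensor_unit_bounds[OF that] by (intro tresca_domain_memI s k tensor_in_Msym)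
  have \<sigma>C: "\<sigma> \<in> tresca_domain k"
    unfolding \<sigma> by (rule mem[OF w])
  have sub: "tresca_domain k \<subseteq> Msym"
    by (auto simp: tresca_domain_def)
  have n': "n \<in> Msym" "\<And>\<eta>. \<eta> \<in> tresca_domain k \<Longrightarrow> n \<bullet> (\<eta> - \<sigma>) \<le> 0"
    using n unfolding normal_cone_iff[OF sub \<sigma>C] by auto
  \<comment> \<open>Changing \<open>a\<close> by one in either direction stays in the domain, which
    gives both inequalities.\<close>
  have "n \<bullet> mat 1 = 0"
    using n'(2)[OF mem[OF w, of "a + 1"]] n'(2)[OF mem[OF w, of "a - 1"]]
    by (simp add: \<sigma> algebra_simps)
  then have tr: "trace n = 0"
    by (simp add: inner_mat_1)
  define c where "c = s * (w \<bullet> (n *v w))"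
  have c_le: "c \<le> s * (u \<bullet> (n *v u))" if "u \<bullet> u = 1" for u
  proof -
    have "k * (c - s * (u \<bullet> (n *v u))) \<le> 0"
      using n'(2)[OF mem[OF that, of a]]
      by (simp add: \<sigma> inner_diff_right inner_tensor c_def algebra_simps)
    then show ?thesis
      using k by (simp add: mult_le_0_iff)
  qed
  have nonneg_unit: "0 \<le> s * (u \<bullet> (n *v u))" if u: "u \<bullet> u = 1" "w \<bullet> u = 0" for u
  proof -
    \<comment> \<open>The trial matrix is the orthogonal projection onto the span of
      \<open>w\<close> and \<open>u\<close>; the upper bound on its form is Bessel's
      inequality.\<close>
    have "a *\<^sub>R mat 1 - (2 * k * s) *\<^sub>R (w \<otimes>\<^sub>v w + u \<otimes>\<^sub>v u) \<in> tresca_domain k"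
    proof (rule tresca_domain_memI[OF s k])
      show "w \<otimes>\<^sub>v w + u \<otimes>\<^sub>v u \<in> Msym"
        by (intro Msym_intros)
      fix y :: "real^3" assume y: "y \<bullet> y = 1"
      have eq: "y \<bullet> ((w \<otimes>\<^sub>v w + u \<otimes>\<^sub>v u) *v y) = (w \<bullet> y)^2 + (u \<bullet> y)^2"
        by (simp add: matrix_vector_mult_add_rdistrib tensor_mult_vector inner_add_right
            power2_eq_square inner_commute)
      have "0 \<le> (y - (w \<bullet> y) *\<^sub>R w - (u \<bullet> y) *\<^sub>R u) \<bullet> (y - (w \<bullet> y) *\<^sub>R w - (u \<bullet> y) *\<^sub>R u)"
        by (rule inner_ge_zero)
      also have "\<dots> = 1 - ((w \<bullet> y)^2 + (u \<bullet> y)^2)"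
        using u w y by (simp add: inner_diff_left inner_diff_right power2_eq_square inner_commute)
      finally show "0 \<le> y \<bullet> ((w \<otimes>\<^sub>v w + u \<otimes>\<^sub>v u) *v y) \<and> y \<bullet> ((w \<otimes>\<^sub>v w + u \<otimes>\<^sub>v u) *v y) \<le> 1"
        unfolding eq by simp
    qed
    from n'(2)[OF this] have "0 \<le> k * (s * (u \<bullet> (n *v u)))"
      by (simp add: \<sigma> inner_diff_right inner_add_right inner_tensor algebra_simps)
    then show ?thesis
      using k by (simp add: zero_le_mult_iff)
  qed
  have unit: "(u /\<^sub>R norm u) \<bullet> (u /\<^sub>R norm u) = 1" if "u \<noteq> 0" for u :: "real^3"
    using that by (simp add: dot_square_norm power2_eq_square)
  have scale: "(u /\<^sub>R norm u) \<bullet> (n *v (u /\<^sub>R norm u)) = (u \<bullet> (n *v u)) / (u \<bullet> u)" for u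
    by (simp add: matrix_vector_mult_scaleR dot_square_norm power2_eq_square field_simps)
  have nonneg: "0 \<le> s * (u \<bullet> (n *v u))" if "w \<bullet> u = 0" for u
  proof (cases "u = 0")
    case False
    have "0 \<le> s * ((u \<bullet> (n *v u)) / (u \<bullet> u))"
      using nonneg_unit[OF unit[OF False]] that unfolding scale by simp
    moreover have "0 < u \<bullet> u"
      using False by simp
    ultimately show ?thesis
      by (simp add: zero_le_divide_iff)
  qed simp
  \<comment> \<open>By \<open>c_le\<close> the form of this matrix is nonnegative, and it vanishes
    at \<open>w\<close> by the choice of \<open>c\<close>.\<close>
  have "(s *\<^sub>R n - c *\<^sub>R mat 1) *v w = 0"
  proof (rule semidefinite_null_vector[OF _ subspace_UNIV])
    have "s *\<^sub>R n - c *\<^sub>R mat 1 \<in> Msym"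
      using n' by (intro Msym_intros)
    then show "transpose (s *\<^sub>R n - c *\<^sub>R mat 1) = s *\<^sub>R n - c *\<^sub>R mat 1"
      by (simp add: Msym_def)
    show "0 \<le> x \<bullet> ((s *\<^sub>R n - c *\<^sub>R mat 1) *v x)" for x
    proof (cases "x = 0")
      case False
      have "c \<le> s * ((x \<bullet> (n *v x)) / (x \<bullet> x))"
        using c_le[OF unit[OF False]] unfolding scale .
      then have "c * (x \<bullet> x) \<le> s * (x \<bullet> (n *v x))"
        using False by (simp add: field_simps)
      then show ?thesis
        by (simp add: matrix_vector_mult_diff_rdistrib inner_diff_right flip: scaleR_matrix_vector_assoc)
    qed simp
  qed (simp_all add: w c_def matrix_vector_mult_diff_rdistrib inner_diff_right
      flip: scaleR_matrix_vector_assoc)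
  then have nw: "s *\<^sub>R (n *v w) = c *\<^sub>R w"
    by (simp add: matrix_vector_mult_diff_rdistrib flip: scaleR_matrix_vector_assoc)
  \<comment> \<open>Since \<open>w\<close> is an eigenvector of \<open>s *\<^sub>R n\<close> for
    \<open>c\<close>, subtracting this spectral part gives a matrix that kills \<open>w\<close> and
    has the form of \<open>s *\<^sub>R n\<close> on its complement.\<close>
  define A where "A = s *\<^sub>R n - c *\<^sub>R (w \<otimes>\<^sub>v w)"
  have Av: "A *v x = s *\<^sub>R (n *v x) - (c * (w \<bullet> x)) *\<^sub>R w" for x
    by (simp add: A_def matrix_vector_mult_diff_rdistrib tensor_mult_vector flip: scaleR_matrix_vector_assoc)
  have A: "A \<in> Msym"
    unfolding A_def using n' by (intro Msym_intros)
  have Aw: "A *v w = 0"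
    by (simp add: Av nw w)
  have "0 \<le> x \<bullet> (A *v x)" for x
  proof -
    define y where "y = x - (w \<bullet> x) *\<^sub>R w"
    have wy: "w \<bullet> y = 0"
      by (simp add: y_def inner_diff_right w)
    have "A *v x = A *v y"
      by (simp add: y_def matrix_vector_mult_diff_distrib matrix_vector_mult_scaleR Aw)
    moreover have "w \<bullet> (A *v y) = 0"
      using symmetric_dot_matrix_vector[of A w y] A Aw by (simp add: Msym_def)
    ultimately have "x \<bullet> (A *v x) = y \<bullet> (A *v y)"
      by (simp add: y_def inner_diff_left)
    also have "\<dots> = s * (y \<bullet> (n *v y))"
      using wy by (simp add: Av inner_diff_right)
    finally show ?thesis
      using nonneg[OF wy] by simp
  qed
  \<comment> \<open>As \<open>n\<close> has trace zero, \<open>c\<close> is recovered from the trace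
    of \<open>A\<close>; this produces the trace term in the claim.\<close>
  moreover have "trace A = - c"
    using tr w by (simp add: A_def inner_mat_1[symmetric] inner_diff_left)
      (simp add: inner_mat_1 trace_tensor)
  then have "s *\<^sub>R (A - trace A *\<^sub>R (w \<otimes>\<^sub>v w)) = n"
    by (simp add: A_def ss)
  ultimately show ?thesis
    using that A Aw by metis
qed

section \<open>The plastic strain rate\<close>

lemma trace_scaleR: "trace (c *\<^sub>R A) = c * trace (A :: real^'n^'n)"
  by (simp add: trace_def sum_distrib_left)

lemmas trace_linear = trace_add trace_sub trace_scaleR trace_I

text \<open>On a subspace the variational inequality holds for \<open>B\<close> and for
  \<open>- B\<close>, so the projection error is orthogonal to the subspace.\<close>

lemma projG_Gspace: "projG m v z \<in> Gspace m v"
  and projG_orthogonal: "B \<in> Gspace m v \<Longrightarrow> B \<bullet> deviator z = B \<bullet> projG m v z"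
proof -
  have sub: "subspace (Gspace m v)"
    using subspace_Msym unfolding subspace_def Gspace_def
    by (auto simp: matrix_vector_mult_add_rdistrib simp flip: scaleR_matrix_vector_assoc)
  then have cl: "closed (Gspace m v)" and cv: "convex (Gspace m v)"
    by (simp_all add: closed_subspace subspace_imp_convex)
  show mem: "projG m v z \<in> Gspace m v"
    unfolding projG_def using subspace_0[OF sub] by (intro closest_point_in_set cl) blast
  assume B: "B \<in> Gspace m v"
  have dot: "(deviator z - projG m v z) \<bullet> C \<le> 0" if "C \<in> Gspace m v" for C
    using closest_point_dot[OF cv cl, of "projG m v z + C" "deviator z"]
      subspace_add[OF sub mem that] by (simp add: projG_def)
  have "(deviator z - projG m v z) \<bullet> B = 0"
    using dot[OF B] dot[OF subspace_neg[OF sub B]] by (simp add: inner_diff_left)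
  then show "B \<bullet> deviator z = B \<bullet> projG m v z"
    by (simp add: inner_diff_left inner_commute[of B])
qed

text \<open>The bracketed matrix is trace-free, so \<open>z\<close> may be replaced by its deviator.
  The pairing then depends only on the projected deviator, also in its \<open>v m\<close>
  component.\<close>

lemma normal_inner:
  assumes s: "s * s = (1::real)" and w: "v m \<bullet> v m = 1" and B: "B \<in> Gspace m v"
  shows "(s *\<^sub>R (B - trace B *\<^sub>R (v m \<otimes>\<^sub>v v m))) \<bullet> z
    = s * (B \<bullet> projG m v z + trace B * trace (projG m v z))"
proof -
  let ?W = "v m \<otimes>\<^sub>v v m" and ?D = "projG m v z"
  have D: "?D *v v m = 0"
    using projG_Gspace[of m v z] by (simp add: Gspace_def)
  \<comment> \<open>Testing the projection against this element expresses the \<open>v m\<close>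
    entry of the trace-free deviator by the trace of its projection.\<close>
  have "mat 1 - ?W \<in> Gspace m v"
    using w by (auto simp: Gspace_def matrix_vector_mult_diff_rdistrib tensor_mult_vector intro!: Msym_intros)
  from projG_orthogonal[OF this, of z]
  have "trace (deviator z) - ?W \<bullet> deviator z = trace ?D"
    using D by (simp add: inner_diff_left inner_commute[of "mat 1"] inner_mat_1 inner_commute[of ?W ?D] inner_tensor)
  moreover have "trace (deviator z) = 0"
    by (simp add: deviator_def trace_linear)
  ultimately have W: "?W \<bullet> deviator z = - trace ?D"
    by simp
  have "trace (B - trace B *\<^sub>R ?W) = 0"
    by (simp add: trace_linear trace_tensor w)
  then have "(B - trace B *\<^sub>R ?W) \<bullet> z = (B - trace B *\<^sub>R ?W) \<bullet> deviator z"
    by (simp add: deviator_def inner_diff_right[of "B - trace B *\<^sub>R ?W"] inner_mat_1)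
  also have "\<dots> = B \<bullet> ?D + trace B * trace ?D"
    by (simp add: inner_diff_left W projG_orthogonal[OF B])
  finally show ?thesis
    by (simp only: inner_scaleR_left)
qed

text \<open>These are the optimality conditions for minimising \<open>(b^2 + c^2 + (b + c)^2) / 2 -
  (b * e + c * f + (b + c) * (e + f))\<close> over \<open>b, c \<ge> 0\<close>: \<open>g\<close> and
  \<open>h\<close> are the negative partial derivatives, and the last equation is complementary
  slackness.\<close>

lemma projected_eigenvalues:
  fixes e f :: real
  defines "r \<equiv> if e = 0 \<and> f = 0 then 0 else max (1/4 + 3/4 * ((e + f) / (\<bar>e\<bar> + \<bar>f\<bar>))) 0"
  defines "b \<equiv> r * (e - min f 0)" and "c \<equiv> r * (f - min f 0)"
  defines "g \<equiv> e - b + (e + f) - (b + c)" and "h \<equiv> f - c + (e + f) - (b + c)"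
  assumes "f \<le> e"
  shows "0 \<le> b \<and> 0 \<le> c \<and> g \<le> 0 \<and> h \<le> 0 \<and> b * g + c * h = 0"
proof -
  consider "0 \<le> f" | "f < 0" "e \<le> 0" | "f < 0" "0 < e"
    by linarith
  then show ?thesis
  proof cases
    case 1
    then have "b = e" "c = f"
      using \<open>f \<le> e\<close> by (auto simp: b_def c_def r_def)
    then show ?thesis
      using 1 \<open>f \<le> e\<close> by (simp add: g_def h_def)
  next
    case 2
    have "(e + f) / (\<bar>e\<bar> + \<bar>f\<bar>) = - 1"
      using 2 by (simp add: divide_eq_eq)
    then have "b = 0" "c = 0"
      by (simp_all add: b_def c_def r_def)
    then show ?thesis
      using 2 by (simp add: g_def h_def)
  next
    case 3
    \<comment> \<open>Here \<open>c = 0\<close>, and \<open>g = 0\<close> would give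
      \<open>b = e + f / 2\<close>. Dividing by \<open>e - min f 0 = e - f\<close> gives the factor,
      which is cut off at zero.\<close>
    have "1/4 + 3/4 * ((e + f) / (\<bar>e\<bar> + \<bar>f\<bar>)) = (e + f / 2) / (e - f)"
      using 3 by (simp add: field_simps)
    then have "r = max ((e + f / 2) / (e - f)) 0"
      using 3 by (simp add: r_def)
    then have "b = max (e + f / 2) 0" "c = 0"
      using 3 by (auto simp: b_def c_def max_def field_simps)
    then show ?thesis
      using 3 by (auto simp: g_def h_def max_def)
  qed
qed

text \<open>Diagonalising \<open>s\<close> times the projection instead of the projection treats
  \<open>m = 1\<close> and \<open>m = 3\<close> at once; \<open>v m\<close> belongs to the
  eigenbasis with eigenvalue 0.\<close>

lemma plastic_flow_eigenform:
  assumes sm: "(s = 1 \<and> m = 3) \<or> (s = (-1::real) \<and> m = 1)" and w: "v m \<bullet> v m = 1"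
  obtains x y e f r where "orthonormal_triple x y (v m)" "f \<le> e"
    "projG m v z = s *\<^sub>R (e *\<^sub>R (x \<otimes>\<^sub>v x) + f *\<^sub>R (y \<otimes>\<^sub>v y))"
    "r = (if e = 0 \<and> f = 0 then 0 else max (1/4 + 3/4 * ((e + f) / (\<bar>e\<bar> + \<bar>f\<bar>))) 0)"
    "rho m v z *\<^sub>R (Smat m v z - trace (Smat m v z) *\<^sub>R (v m \<otimes>\<^sub>v v m)) =
      s *\<^sub>R ((r * (e - min f 0)) *\<^sub>R (x \<otimes>\<^sub>v x) + (r * (f - min f 0)) *\<^sub>R (y \<otimes>\<^sub>v y)
        - (r * (e - min f 0) + r * (f - min f 0)) *\<^sub>R (v m \<otimes>\<^sub>v v m))"
proof -
  define D where "D = projG m v z"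
  have ss: "s * s = 1"
    using sm by auto
  have D: "D \<in> Msym" "D *v v m = 0"
    using projG_Gspace[of m v z] by (auto simp: D_def Gspace_def)
  have sD: "s *\<^sub>R D \<in> Msym" "(s *\<^sub>R D) *v v m = 0 *\<^sub>R v m"
    using D by (auto intro: Msym_intros simp flip: scaleR_matrix_vector_assoc)
  obtain x y e f where xy: "orthonormal_triple x y (v m)" "(s *\<^sub>R D) *v x = e *\<^sub>R x"
    "(s *\<^sub>R D) *v y = f *\<^sub>R y" "f \<le> e"
    using symmetric_eigenbasis_extend[OF sD(1) w sD(2)] .
  note on = orthonormal_tripleD[OF xy(1)]
  have "s *\<^sub>R D = e *\<^sub>R (x \<otimes>\<^sub>v x) + f *\<^sub>R (y \<otimes>\<^sub>v y)"
    using orthonormal_triple_spectral[OF xy(1-3) sD(2)] by simp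
  then have "s *\<^sub>R (s *\<^sub>R D) = s *\<^sub>R (e *\<^sub>R (x \<otimes>\<^sub>v x) + f *\<^sub>R (y \<otimes>\<^sub>v y))"
    by simp
  then have D_eq: "D = s *\<^sub>R (e *\<^sub>R (x \<otimes>\<^sub>v x) + f *\<^sub>R (y \<otimes>\<^sub>v y))"
    by (simp add: ss)
  have Dx: "D *v x = (s * e) *\<^sub>R x" and Dy: "D *v y = (s * f) *\<^sub>R y" and Dw: "D *v v m = 0 *\<^sub>R v m"
    unfolding D_eq
    by (simp_all add: matrix_vector_mult_add_rdistrib tensor_mult_vector on flip: scaleR_matrix_vector_assoc)
  have D0: "D = 0 \<longleftrightarrow> e = 0 \<and> f = 0"
  proof
    assume "D = 0"
    moreover have "s \<noteq> 0" "x \<noteq> 0" "y \<noteq> 0"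
      using ss on by auto
    ultimately show "e = 0 \<and> f = 0"
      using Dx Dy by simp
  qed (simp add: D_eq)
  have ev: "eigvals D = rev (sort [s * e, s * f, 0])"
    by (rule eigvals_orthonormal_triple[OF xy(1) Dx Dy Dw])
  have sum3: "(\<Sum>j=1..3. g j) = g 1 + g 2 + g 3" for g :: "nat \<Rightarrow> real"
    by (simp add: numeral_eq_Suc)
  \<comment> \<open>For \<open>m = 3\<close> this is the least of \<open>e\<close>,
    \<open>f\<close>, \<open>0\<close>; for \<open>m = 1\<close> it is the greatest of
    \<open>- e\<close>, \<open>- f\<close>, \<open>0\<close>.\<close>
  have ev_m: "eigval m D = s * min f 0"
    using sm \<open>f \<le> e\<close> by (auto simp: eigval_def ev min_def)
  have ev_sum: "(\<Sum>j=1..3. eigval j D) = s * (e + f)"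
    unfolding sum3 by (auto simp: eigval_def ev algebra_simps)
  have ev_abs: "(\<Sum>j=1..3. \<bar>eigval j D\<bar>) = \<bar>e\<bar> + \<bar>f\<bar>"
    unfolding sum3 using sm by (auto simp: eigval_def ev)
  have sgn: "(-1) ^ ((3 - m) div 2) = s"
    using sm by auto
  define r where "r = (if e = 0 \<and> f = 0 then 0 else max (1/4 + 3/4 * ((e + f) / (\<bar>e\<bar> + \<bar>f\<bar>))) 0)"
  \<comment> \<open>The sign in the definition of \<open>rho\<close> cancels the sign of the
    eigenvalue sum.\<close>
  have "s * (3/4) * (s * (e + f) / (\<bar>e\<bar> + \<bar>f\<bar>)) = 3/4 * ((e + f) / (\<bar>e\<bar> + \<bar>f\<bar>))"
    using sm by auto
  then have rho: "rho m v z = r"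
    unfolding rho_def D_def[symmetric] ev_sum ev_abs sgn D0 r_def by (simp only:)
  define c where "c = s * min f 0"
  have S: "Smat m v z = D - c *\<^sub>R mat 1"
    by (simp add: Smat_def ev_m c_def flip: D_def)
  have tr: "trace (Smat m v z) = s * (e + f) - 3 * c"
    unfolding S D_eq by (simp add: trace_linear trace_tensor on)
  \<comment> \<open>Resolving the identity in the eigenbasis leaves the \<open>v m\<close>
    coefficient \<open>- (s * (e + f) - 2 * c)\<close>, which makes the matrix trace-free.\<close>
  have "Smat m v z - trace (Smat m v z) *\<^sub>R (v m \<otimes>\<^sub>v v m) =
      s *\<^sub>R ((e - min f 0) *\<^sub>R (x \<otimes>\<^sub>v x) + (f - min f 0) *\<^sub>R (y \<otimes>\<^sub>v y)
        - ((e - min f 0) + (f - min f 0)) *\<^sub>R (v m \<otimes>\<^sub>v v m))"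
    unfolding tr unfolding S D_eq orthonormal_triple_resolution[OF xy(1)] c_def
    by (simp add: algebra_simps, simp flip: scaleR_add_left)
  then have "rho m v z *\<^sub>R (Smat m v z - trace (Smat m v z) *\<^sub>R (v m \<otimes>\<^sub>v v m)) =
      s *\<^sub>R ((r * (e - min f 0)) *\<^sub>R (x \<otimes>\<^sub>v x) + (r * (f - min f 0)) *\<^sub>R (y \<otimes>\<^sub>v y)
        - (r * (e - min f 0) + r * (f - min f 0)) *\<^sub>R (v m \<otimes>\<^sub>v v m))"
    unfolding rho by (simp add: scaleR_add_right scaleR_diff_right mult.left_commute, simp add: algebra_simps)
  then show ?thesis
    using that[OF xy(1,4) _ r_def] D_eq by (simp add: D_def)
qed

text \<open>Establishes the three conditions of \<open>moreau_decomposition\<close> for the explicit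
  flow, by reducing each to the optimality conditions in
  \<open>projected_eigenvalues\<close>.\<close>

lemma plastic_flow_normal_cone:
  fixes z :: "real^3^3"
  assumes sm: "(s = 1 \<and> m = 3) \<or> (s = (-1::real) \<and> m = 1)" and k: "0 < k" and w: "v m \<bullet> v m = 1"
    and \<sigma>: "\<sigma> = a *\<^sub>R mat 1 - (2 * k * s) *\<^sub>R (v m \<otimes>\<^sub>v v m)"
  defines "p \<equiv> rho m v z *\<^sub>R (Smat m v z - trace (Smat m v z) *\<^sub>R (v m \<otimes>\<^sub>v v m))"
  shows "p \<in> normal_cone (tresca_domain k) \<sigma>" "p \<bullet> (z - p) = 0"
    "n \<in> normal_cone (tresca_domain k) \<sigma> \<Longrightarrow> n \<bullet> (z - p) \<le> 0"
proof -
  let ?W = "v m \<otimes>\<^sub>v v m"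
  have s: "s = 1 \<or> s = -1" and ss: "s * s = 1"
    using sm by auto
  obtain x y e f r where xy: "orthonormal_triple x y (v m)" and fe: "f \<le> e"
    and D: "projG m v z = s *\<^sub>R (e *\<^sub>R (x \<otimes>\<^sub>v x) + f *\<^sub>R (y \<otimes>\<^sub>v y))"
    and r: "r = (if e = 0 \<and> f = 0 then 0 else max (1/4 + 3/4 * ((e + f) / (\<bar>e\<bar> + \<bar>f\<bar>))) 0)"
    and p: "rho m v z *\<^sub>R (Smat m v z - trace (Smat m v z) *\<^sub>R (v m \<otimes>\<^sub>v v m)) =
      s *\<^sub>R ((r * (e - min f 0)) *\<^sub>R (x \<otimes>\<^sub>v x) + (r * (f - min f 0)) *\<^sub>R (y \<otimes>\<^sub>v y)
        - (r * (e - min f 0) + r * (f - min f 0)) *\<^sub>R (v m \<otimes>\<^sub>v v m))"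
    using plastic_flow_eigenform[of s m v z, OF sm w] .
  note on = orthonormal_tripleD[OF xy]
  define b where "b = r * (e - min f 0)"
  define c where "c = r * (f - min f 0)"
  define g where "g = e - b + (e + f) - (b + c)"
  define h where "h = f - c + (e + f) - (b + c)"
  have bc: "0 \<le> b" "0 \<le> c" and gh: "g \<le> 0" "h \<le> 0" "b * g + c * h = 0"
    using projected_eigenvalues[OF fe] unfolding r[symmetric] b_def[symmetric] c_def[symmetric]
    by (simp_all add: g_def h_def)
  define B where "B = b *\<^sub>R (x \<otimes>\<^sub>v x) + c *\<^sub>R (y \<otimes>\<^sub>v y)"
  have trB: "trace B = b + c"
    by (simp add: B_def trace_linear trace_tensor on)
  have p_eq: "p = s *\<^sub>R (B - trace B *\<^sub>R ?W)"
    unfolding p_def p trB by (simp add: B_def b_def c_def)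
  have Bv: "B *v u = (b * (x \<bullet> u)) *\<^sub>R x + (c * (y \<bullet> u)) *\<^sub>R y" for u
    by (simp add: B_def matrix_vector_mult_add_rdistrib tensor_mult_vector flip: scaleR_matrix_vector_assoc)
  have B: "B \<in> Msym" "B *v v m = 0"
    by (auto simp: B_def intro!: Msym_intros) (simp add: on Bv flip: B_def)
  have Bnn: "0 \<le> u \<bullet> (B *v u)" for u
    using bc by (simp add: Bv inner_add_right inner_commute[of u] mult.assoc)
  show pN: "p \<in> normal_cone (tresca_domain k) \<sigma>"
    unfolding p_eq by (rule tresca_normal_coneI[OF s k w \<sigma> B Bnn])
  \<comment> \<open>The pairing of any normal with the residual sees only the diagonal entries of
    \<open>A\<close> at \<open>x\<close> and \<open>y\<close>. For \<open>A = B\<close> these are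
    \<open>b\<close> and \<open>c\<close>, so slackness gives orthogonality; for general normals
    they are nonnegative.\<close>
  have key: "(s *\<^sub>R (A - trace A *\<^sub>R ?W)) \<bullet> (z - p) = (x \<bullet> (A *v x)) * g + (y \<bullet> (A *v y)) * h"
    if A: "A \<in> Msym" "A *v v m = 0" for A
  proof -
    define X where "X = x \<bullet> (A *v x)"
    define Y where "Y = y \<bullet> (A *v y)"
    have trA: "trace A = X + Y"
      by (simp add: inner_mat_1[symmetric] orthonormal_triple_resolution[OF xy] inner_add_right
          inner_tensor A X_def Y_def)
    have "A \<in> Gspace m v"
      using A by (simp add: Gspace_def)
    from normal_inner[of s v m, OF ss w this, of z]
    have z: "(s *\<^sub>R (A - trace A *\<^sub>R ?W)) \<bullet> z = s * s * (e * X + f * Y + (X + Y) * (e + f))"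
      unfolding D trA by (simp add: inner_add_right inner_tensor trace_linear trace_tensor on
          X_def[symmetric] Y_def[symmetric] algebra_simps)
    have "?W \<bullet> ?W = 1" "?W \<bullet> B = 0" "A \<bullet> ?W = 0"
      using A by (simp_all add: inner_commute[of ?W B] inner_tensor tensor_mult_vector w B)
    moreover have "A \<bullet> B = b * X + c * Y"
      by (simp add: B_def inner_add_right inner_tensor X_def Y_def)
    ultimately have "(s *\<^sub>R (A - trace A *\<^sub>R ?W)) \<bullet> p = s * s * (b * X + c * Y + (X + Y) * (b + c))"
      unfolding p_eq trA trB by (simp add: inner_diff_left inner_diff_right algebra_simps)
    with z show ?thesis
      unfolding inner_diff_right[of _ z p] X_def[symmetric] Y_def[symmetric] g_def h_def ss
      by (simp add: algebra_simps)
  qed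
  show "p \<bullet> (z - p) = 0"
    using key[OF B] gh(3) unfolding p_eq[symmetric] by (simp add: Bv inner_add_right on)
  show "n \<bullet> (z - p) \<le> 0" if n: "n \<in> normal_cone (tresca_domain k) \<sigma>"
  proof -
    obtain A where A: "A \<in> Msym" "A *v v m = 0" "\<And>x. 0 \<le> x \<bullet> (A *v x)"
      "n = s *\<^sub>R (A - trace A *\<^sub>R ?W)"
      using tresca_normal_coneE[OF s k w \<sigma> n] by metis
    show ?thesis
      unfolding A(4) key[OF A(1,2)] using A(3) gh by (intro add_nonpos_nonpos mult_nonneg_nonpos)
  qed
qed

text \<open>Two eigenvalues coincide, so \<open>\<sigma>\<close> differs from a multiple of the
  identity only along \<open>v m\<close>. The deviation is minus the eigenvalue gap for
  \<open>m = 3\<close> and plus the gap for \<open>m = 1\<close>.\<close>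

lemma tresca_edge_stress:
  assumes v: "eigenbasis \<sigma> v" and m: "m = 1 \<or> m = 3" and ev: "eigval 2 \<sigma> = eigval (4 - m) \<sigma>"
  defines "s \<equiv> if m = 3 then 1 else - 1 :: real"
  shows "\<sigma> = eigval 2 \<sigma> *\<^sub>R mat 1 - (2 * f_tresca \<sigma> * s) *\<^sub>R (v m \<otimes>\<^sub>v v m)"
proof -
  have f: "2 * f_tresca \<sigma> = eigval 1 \<sigma> - eigval 3 \<sigma>"
    by (simp add: f_tresca_def)
  have on: "orthonormal_triple (v 1) (v 2) (v 3)"
    using v by (simp add: eigenbasis_def orthonormal_triple_def)
  have eig: "\<sigma> *v v 1 = eigval 1 \<sigma> *\<^sub>R v 1" "\<sigma> *v v 2 = eigval 2 \<sigma> *\<^sub>R v 2" "\<sigma> *v v 3 = eigval 3 \<sigma> *\<^sub>R v 3"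
    using v by (auto simp: eigenbasis_def)
  note spec = orthonormal_triple_spectral[OF on eig]
  show ?thesis
    using m ev unfolding orthonormal_triple_resolution[OF on] s_def f
    by (subst spec) (auto simp: algebra_simps)
qed

section \<open>The flow rule from Moreau's decomposition\<close>

theorem theorem4p5:
  fixes k \<mu> lam :: real
    and \<sigma> \<epsilon> \<epsilon>e \<epsilon>p \<sigma>d :: "real^3^3"
    and l m :: nat
    and v :: "nat \<Rightarrow> real^3"
  assumes "k > 0" and "\<mu> > 0" and "lam > 0"
    and "\<sigma> \<in> Msym" and "f_tresca \<sigma> = k"
    and "l \<in> {1, 3}" and "m = 4 - l"
    and "eigval 2 \<sigma> = eigval l \<sigma>" and "eigval 2 \<sigma> \<noteq> eigval m \<sigma>"
    and "eigenbasis \<sigma> v"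
    and "\<epsilon> \<in> Msym" and "\<epsilon>e \<in> Msym" and "\<epsilon>p \<in> Msym" and "\<sigma>d \<in> Msym"
  shows
    "(\<epsilon>e = closest_point (tangent_cone (tresca_domain k) \<sigma>) \<epsilon> \<and>
      \<epsilon>p = closest_point (normal_cone (tresca_domain k) \<sigma>) \<epsilon> \<and>
      \<sigma>d = closest_point (tangent_cone (tresca_domain k) \<sigma>) (elasticity \<mu> lam \<epsilon>))
     \<longleftrightarrow>
     (\<epsilon>p = rho m v \<epsilon> *\<^sub>R (Smat m v \<epsilon> - trace (Smat m v \<epsilon>) *\<^sub>R (v m \<otimes>\<^sub>v v m)) \<and>
      \<epsilon>e = \<epsilon> - \<epsilon>p \<and>
      \<sigma>d = (lam * trace \<epsilon>) *\<^sub>R mat 1 +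
           (2 * \<mu>) *\<^sub>R (\<epsilon> - rho m v \<epsilon> *\<^sub>R
             (Smat m v \<epsilon> - trace (Smat m v \<epsilon>) *\<^sub>R (v m \<otimes>\<^sub>v v m))))"
proof -
  let ?C = "tresca_domain k"
  define s :: real where "s = (if m = 3 then 1 else - 1)"
  define p where "p = rho m v \<epsilon> *\<^sub>R (Smat m v \<epsilon> - trace (Smat m v \<epsilon>) *\<^sub>R (v m \<otimes>\<^sub>v v m))"
  have m: "m = 1 \<or> m = 3" "4 - m = l"
    using assms(6,7) by auto
  have sm: "(s = 1 \<and> m = 3) \<or> (s = -1 \<and> m = 1)" and s: "s = 1 \<or> s = -1"
    using m by (auto simp: s_def)
  have w: "v m \<bullet> v m = 1"
    using assms(10) m(1) by (auto simp: eigenbasis_def)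
  have \<sigma>: "\<sigma> = eigval 2 \<sigma> *\<^sub>R mat 1 - (2 * k * s) *\<^sub>R (v m \<otimes>\<^sub>v v m)"
    using tresca_edge_stress[OF assms(10) m(1)] assms(5,8) by (simp add: m(2) s_def)
  note flow = plastic_flow_normal_cone[of s m k v, OF sm assms(1) w \<sigma>, where z = \<epsilon>, folded p_def]
  have C: "?C \<subseteq> Msym" "convex ?C" "\<sigma> \<in> ?C"
    using assms(4,5) convex_tresca_domain by (auto simp: tresca_domain_def)
  have \<epsilon>: "closest_point (normal_cone ?C \<sigma>) \<epsilon> = p" "closest_point (tangent_cone ?C \<sigma>) \<epsilon> = \<epsilon> - p"
    using moreau_decomposition[OF C assms(11) flow] by auto
  have H: "elasticity \<mu> lam \<epsilon> - (2 * \<mu>) *\<^sub>R p = (lam * trace \<epsilon>) *\<^sub>R mat 1 + (2 * \<mu>) *\<^sub>R (\<epsilon> - p)"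
    by (simp add: elasticity_def algebra_simps)
  \<comment> \<open>Normals are orthogonal to the identity, so the volumetric part of
    \<open>elasticity\<close> does not enter their products with the stress rate.\<close>
  have traceless: "trace n = 0" if n: "n \<in> normal_cone ?C \<sigma>" for n
  proof -
    obtain A where "n = s *\<^sub>R (A - trace A *\<^sub>R (v m \<otimes>\<^sub>v v m))"
      using tresca_normal_coneE[OF s assms(1) w \<sigma> n] by metis
    then show ?thesis
      by (simp add: trace_linear trace_tensor w)
  qed
  have inner_H: "n \<bullet> (elasticity \<mu> lam \<epsilon> - (2 * \<mu>) *\<^sub>R p) = 2 * \<mu> * (n \<bullet> (\<epsilon> - p))"
    if "n \<in> normal_cone ?C \<sigma>" for n
    unfolding H by (simp add: inner_add_right inner_mat_1 traceless[OF that])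
  \<comment> \<open>The normal part of the elastic image is \<open>2 * \<mu>\<close> times the
    plastic strain rate, so its Moreau conditions are those of \<open>\<epsilon>\<close> scaled by a
    positive factor.\<close>
  have "closest_point (tangent_cone ?C \<sigma>) (elasticity \<mu> lam \<epsilon>) = elasticity \<mu> lam \<epsilon> - (2 * \<mu>) *\<^sub>R p"
  proof (rule moreau_decomposition(2)[OF C])
    show "elasticity \<mu> lam \<epsilon> \<in> Msym"
      unfolding elasticity_def using assms(11) by (intro Msym_intros)
    show "(2 * \<mu>) *\<^sub>R p \<in> normal_cone ?C \<sigma>"
      using flow(1) assms(2) unfolding normal_cone_iff[OF C(1,3)]
      by (auto simp: mult_nonneg_nonpos intro: Msym_intros)
    show "((2 * \<mu>) *\<^sub>R p) \<bullet> (elasticity \<mu> lam \<epsilon> - (2 * \<mu>) *\<^sub>R p) = 0"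
      using inner_H[OF flow(1)] flow(2) by simp
    show "n \<bullet> (elasticity \<mu> lam \<epsilon> - (2 * \<mu>) *\<^sub>R p) \<le> 0" if "n \<in> normal_cone ?C \<sigma>" for n
      unfolding inner_H[OF that] using flow(3)[OF that] assms(2) by (simp add: mult_nonneg_nonpos)
  qed
  then show ?thesis
    unfolding p_def[symmetric] \<epsilon> H by auto
qed

end
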